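(* Let $\beta\in\mathbb{C}$ be an algebraic number with $|\beta|>1$ such that $|\beta'|=1$ for some Galois conjugate $\beta'$ of $\beta$. Then there exists a finite set $\mathcal{A}\subset\mathbb{Z}$ such that $\frac1n\in\operatorname{Per}_{\mathcal{A}}(\beta)$ for all positive integers $n$.
   Context: An alphabet is a finite set $\mathcal{A}\subset\mathbb{C}$ containing $0$. For $\beta\in\mathbb{C}$ with $|\beta|>1$ and an alphabet $\mathcal{A}$, the set $\operatorname{Per}_{\mathcal{A}}(\beta)$ of numbers having an eventually periodic $(\beta,\mathcal{A})$-representation is $$\operatorname{Per}_{\mathcal{A}}(\beta)=\Big\{\sum_{k=-L}^{+\infty}a_k\beta^{-k}\ :\ L\in\mathbb{Z},\ a_k\in\mathcal{A}\text{ for all }k\ge -L,\ (a_k)_{k\geq -L}\text{ is eventually periodic}\Big\}.$$ The Galois conjugates of $\beta$ are the complex roots of its minimal polynomial over $\mathbb{Q}$ (including $\beta$ itself). *)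

theory Defs
  imports "HOL-Analysis.Analysis" "HOL-Computational_Algebra.Computational_Algebra"
begin

definition is_min_poly :: "complex \<Rightarrow> rat poly \<Rightarrow> bool" where
  "is_min_poly x p \<longleftrightarrow>
     lead_coeff p = 1 \<and> poly (map_poly of_rat p) x = 0 \<and>
     (\<forall>q. q \<noteq> 0 \<and> poly (map_poly of_rat q) x = 0 \<longrightarrow> degree p \<le> degree q)"

text \<open>Meaningful for algebraic \<open>x\<close> only; see \<open>ex1_min_poly\<close> below.\<close>

definition min_poly :: "complex \<Rightarrow> rat poly" where
  "min_poly x = (THE p. is_min_poly x p)"

definition galois_conjugates :: "complex \<Rightarrow> complex set" where
  "galois_conjugates x = {z. poly (map_poly of_rat (min_poly x)) z = 0}"

definition alphabet :: "complex set \<Rightarrow> bool" where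
  "alphabet A \<longleftrightarrow> finite A \<and> 0 \<in> A"

text \<open>A sequence \<open>(a\<^sub>k)\<close> with \<open>k \<ge> m\<close> is encoded as a function on all integers whose
  values below \<open>m\<close> are ignored.\<close>

definition eventually_periodic_from :: "int \<Rightarrow> (int \<Rightarrow> 'a) \<Rightarrow> bool" where
  "eventually_periodic_from m a \<longleftrightarrow> (\<exists>N\<ge>m. \<exists>p>0. \<forall>k\<ge>N. a (k + p) = a k)"

text \<open>For \<open>\<bar>\<beta>\<bar> > 1\<close> and a finite \<open>A\<close> the series converges absolutely, so that its
  unordered sum is the usual sum of the series.\<close>

definition Per :: "complex set \<Rightarrow> complex \<Rightarrow> complex set" where
  "Per A \<beta> = {x. \<exists>(L::int) (a :: int \<Rightarrow> complex).
     (\<forall>k\<ge>-L. a k \<in> A) \<and> eventually_periodic_from (-L) a \<and>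
     ((\<lambda>k. a k * \<beta> powi (-k)) has_sum x) {-L..}}"

lemma ex1_min_poly:
  assumes "algebraic x"
  shows "\<exists>!p. is_min_poly x p"
proof -
  define R where "R q \<longleftrightarrow> q \<noteq> 0 \<and> poly (map_poly of_rat q) x = 0" for q :: "rat poly"
  obtain p0 :: "int poly" where p0: "p0 \<noteq> 0" "poly (map_poly of_int p0) x = 0"
    using algebraicE'[OF assms] by blast
  have "map_poly of_rat (map_poly of_int p0 :: rat poly) = (map_poly of_int p0 :: complex poly)"
    by (intro poly_eqI) (simp add: coeff_map_poly)
  moreover have "(map_poly of_int p0 :: rat poly) \<noteq> 0"
    using p0(1) by (auto simp: poly_eq_iff coeff_map_poly)
  ultimately have "R (map_poly of_int p0)"
    using p0(2) by (simp add: R_def)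
  then obtain q where q: "R q" and q_min: "\<And>r. R r \<Longrightarrow> degree q \<le> degree r"
    using ex_has_least_nat[of R _ degree] by blast
  have smult: "map_poly of_rat (smult c r) = smult (of_rat c) (map_poly of_rat r :: complex poly)"
    for c and r :: "rat poly"
    by (intro poly_eqI) (simp add: coeff_map_poly of_rat_mult)
  have diff: "map_poly of_rat (r - s) = (map_poly of_rat r - map_poly of_rat s :: complex poly)"
    for r s :: "rat poly"
    by (intro poly_eqI) (simp add: coeff_map_poly of_rat_diff)
  have "is_min_poly x (smult (inverse (lead_coeff q)) q)"
    using q q_min by (auto simp: is_min_poly_def R_def smult)
  moreover have "r = s" if r: "is_min_poly x r" and s: "is_min_poly x s" for r s
  proof (rule ccontr)
    assume "r \<noteq> s"
    have nz: "r \<noteq> 0" "s \<noteq> 0"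
      using r s by (auto simp: is_min_poly_def)
    have deg: "degree r = degree s"
      using r s nz by (auto simp: is_min_poly_def intro!: antisym)
    have "R (r - s)"
      using r s \<open>r \<noteq> s\<close> by (auto simp: R_def is_min_poly_def diff)
    then have "degree r \<le> degree (r - s)"
      using r by (auto simp: R_def is_min_poly_def)
    moreover have "degree (r - s) \<le> degree r"
      using degree_diff_le[of r "degree r" s] deg by simp
    ultimately have "lead_coeff (r - s) = 0"
      using r s deg by (simp add: is_min_poly_def)
    then have "r - s = 0"
      by (rule leading_coeff_0_iff[THEN iffD1])
    then show False
      using \<open>r \<noteq> s\<close> by simp
  qed
  ultimately show ?thesis by blast
qed

lemma is_min_poly_min_poly:
  assumes "algebraic x"
  shows "is_min_poly x (min_poly x)"
  unfolding min_poly_def by (rule theI') (rule ex1_min_poly[OF assms])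

end

theory Submission
  imports Defs "HOL-Number_Theory.Cong"
begin

text \<open>
  A two-sided sequence \<open>a\<close> that vanishes far to the left stands for the number
  \<open>\<Sum>\<^sub>k a\<^sub>k \<beta>\<^sup>-\<^sup>k\<close>. Multiplying that number by \<open>\<beta>\<close> shifts the sequence, so an integer
  polynomial \<open>f\<close> acts on sequences, and the sequence \<open>f \<cdot> v\<close> stands for \<open>f(\<beta>)\<close> times the number
  of \<open>v\<close>. If \<open>f(\<beta>) = 0\<close>, then adding \<open>f \<cdot> v\<close>, or a fraction of it, to a
  representation changes the digits but not the represented number.

  The number \<open>1/n\<close> has the one-digit representation \<open>\<delta>/n\<close>, where \<open>\<delta>\<close> is \<open>1\<close> at \<open>0\<close> and vanishes
  elsewhere. Its digit is not an integer, which is repaired by passing to \<open>(\<delta> + f \<cdot> v)/n\<close>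
  with an integer sequence \<open>v\<close> such that \<open>f \<cdot> v \<equiv> -\<delta>\<close> modulo \<open>n\<close>. Only the residues of
  \<open>v\<close> matter for this congruence, so \<open>v\<close> may be taken with values in \<open>[0, n)\<close>. The new
  digits are then bounded by \<open>1 + \<Sum>\<^sub>j \<bar>f\<^sub>j\<bar>\<close>, and in this bound \<open>n\<close> has cancelled: one alphabet
  serves all \<open>n\<close>.

  It remains to solve the congruence by an eventually periodic \<open>v\<close>. For this \<open>f\<close> is chosen
  with content \<open>1\<close>. Modulo a prime \<open>P\<close> some coefficient of \<open>f\<close> survives, so the congruence is
  a linear recurrence over a finite field with invertible leading coefficient; its
  solution is eventually periodic by the pigeonhole principle
  (\<open>poly_act_solvable_mod_prime\<close>). A composite modulus is reached by correcting a solution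
  modulo \<open>m\<close> to one modulo \<open>P m\<close> (\<open>poly_act_solvable_mod\<close>). That step has to solve for
  a new right-hand side, the previous error divided by \<open>m\<close>; this is why the congruence is
  treated for every eventually periodic right-hand side and not only for \<open>-\<delta>\<close>.
\<close>

section \<open>Eventually periodic Laurent sequences\<close>

definition laurent_periodic :: "(int \<Rightarrow> 'a::zero) \<Rightarrow> bool" where
  "laurent_periodic a \<longleftrightarrow> (\<exists>m. (\<forall>k<m. a k = 0) \<and> eventually_periodic_from m a)"

text \<open>
  In the introduction rule the start \<open>m\<close> of the support and the start \<open>N\<close> of the period need
  not be ordered, which saves a case distinction in every application.
\<close>

lemma laurent_periodicI:
  assumes "\<And>k. k < m \<Longrightarrow> a k = 0" "\<And>k. k \<ge> N \<Longrightarrow> a (k + p) = a k" "p > 0"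
  shows "laurent_periodic a"
  unfolding laurent_periodic_def eventually_periodic_from_def
  using assms by (intro exI[of _ m] conjI exI[of _ "max m N"] exI[of _ p]) auto

lemma laurent_periodicE:
  assumes "laurent_periodic a"
  obtains m N p where "\<And>k. k < m \<Longrightarrow> a k = 0" "p > 0" "\<And>k. k \<ge> N \<Longrightarrow> a (k + p) = a k"
  using assms unfolding laurent_periodic_def eventually_periodic_from_def by blast

lemma periodic_multiple:
  fixes a :: "int \<Rightarrow> 'a"
  assumes "\<And>k. k \<ge> N \<Longrightarrow> a (k + p) = a k" "p > 0" "q \<ge> 0" "k \<ge> N"
  shows "a (k + q * p) = a k"
  using \<open>q \<ge> 0\<close>
proof (induction q rule: int_ge_induct)
  case (step q)
  have "k + q * p \<ge> N"
    using assms step.hyps by (simp add: add_increasing2)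
  then show ?case
    using assms(1)[of "k + q * p"] step.IH by (simp add: algebra_simps)
qed simp

text \<open>
  The product of two periods is a common period, so any digitwise operation that fixes \<open>0\<close>
  preserves the class; sums, differences, quotients and residues of digits are all instances.
\<close>

lemma laurent_periodic_map2:
  assumes "laurent_periodic a" "laurent_periodic b" "g 0 0 = 0"
  shows "laurent_periodic (\<lambda>k. g (a k) (b k))"
proof -
  obtain m N p where a: "\<And>k. k < m \<Longrightarrow> a k = 0" "p > 0" "\<And>k. k \<ge> N \<Longrightarrow> a (k + p) = a k"
    using assms(1) by (elim laurent_periodicE) blast
  obtain m' N' p' where b: "\<And>k. k < m' \<Longrightarrow> b k = 0" "p' > 0" "\<And>k. k \<ge> N' \<Longrightarrow> b (k + p') = b k"
    using assms(2) by (elim laurent_periodicE) blast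
  show ?thesis
  proof (rule laurent_periodicI)
    show "g (a k) (b k) = 0" if "k < min m m'" for k
      using that a(1) b(1) assms(3) by simp
    show "g (a (k + p * p')) (b (k + p * p')) = g (a k) (b k)" if "k \<ge> max N N'" for k
      using that periodic_multiple[of N a p p' k] periodic_multiple[of N' b p' p k] a b
      by (simp add: mult.commute)
    show "p * p' > 0"
      using a b by simp
  qed
qed

lemma laurent_periodic_map:
  assumes "laurent_periodic a" "g 0 = 0"
  shows "laurent_periodic (\<lambda>k. g (a k))"
  using laurent_periodic_map2[OF assms(1) assms(1), of "\<lambda>x _. g x"] assms(2) by simp

lemma laurent_periodic_shift:
  assumes "laurent_periodic a"
  shows "laurent_periodic (\<lambda>k. a (k + j))"
proof -
  obtain m N p where a: "\<And>k. k < m \<Longrightarrow> a k = 0" "p > 0" "\<And>k. k \<ge> N \<Longrightarrow> a (k + p) = a k"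
    using assms by (elim laurent_periodicE) blast
  show ?thesis
  proof (rule laurent_periodicI)
    show "a (k + j) = 0" if "k < m - j" for k
      using that a(1) by simp
    show "a (k + p + j) = a (k + j)" if "k \<ge> N - j" for k
      using that a(3)[of "k + j"] by (simp add: algebra_simps)
  qed (rule a(2))
qed

lemma laurent_periodic_finite_support:
  assumes "\<And>k. k < m \<Longrightarrow> a k = 0" "\<And>k. k \<ge> N \<Longrightarrow> a k = 0"
  shows "laurent_periodic a"
  by (rule laurent_periodicI[of m _ N 1]) (use assms in auto)

lemma laurent_periodic_sum:
  fixes a :: "'i \<Rightarrow> int \<Rightarrow> 'a::comm_monoid_add"
  assumes "finite I" "\<And>i. i \<in> I \<Longrightarrow> laurent_periodic (a i)"
  shows "laurent_periodic (\<lambda>k. \<Sum>i\<in>I. a i k)"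
  using assms
proof (induction I rule: finite_induct)
  case empty
  then show ?case
    by (simp add: laurent_periodic_finite_support)
next
  case (insert i I)
  then show ?case
    using laurent_periodic_map2[of "a i" "\<lambda>k. \<Sum>i\<in>I. a i k" "(+)"] by simp
qed

section \<open>Polynomials acting on sequences\<close>

text \<open>
  The variable acts as the shift that moves the digit at position \<open>k + 1\<close> to position \<open>k\<close>,
  because the digit at position \<open>k\<close> is weighted by \<open>\<beta>\<^sup>-\<^sup>k\<close> and multiplication by \<open>\<beta>\<close> lowers the
  position by one.
\<close>

definition poly_act :: "int poly \<Rightarrow> (int \<Rightarrow> int) \<Rightarrow> int \<Rightarrow> int" where
  "poly_act f a k = (\<Sum>j\<le>degree f. coeff f j * a (k + int j))"

lemma laurent_periodic_poly_act:
  assumes "laurent_periodic a"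
  shows "laurent_periodic (poly_act f a)"
  unfolding poly_act_def[abs_def]
  by (intro laurent_periodic_sum laurent_periodic_map[where g = "(*) _"] laurent_periodic_shift assms)
     auto

lemma poly_act_diff_scaled:
  "poly_act f (\<lambda>k. a k - m * b k) k = poly_act f a k - m * poly_act f b k"
  by (simp add: poly_act_def algebra_simps sum_subtractf sum_distrib_left)

lemma poly_act_mod:
  "[poly_act f (\<lambda>k. a k mod n) k = poly_act f a k] (mod n)"
  unfolding poly_act_def by (intro cong_sum cong_mult cong_refl) (simp add: cong_def)

section \<open>Recurrences over a finite set\<close>

text \<open>
  The sequence starts with \<open>t\<close> zeros, and each later term is computed from the window of the
  \<open>t\<close> terms before it. The map \<open>F\<close> also receives the time \<open>k\<close>, so that the recurrence can be
  driven by an external input.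
\<close>

function window_seq :: "(nat \<Rightarrow> int list \<Rightarrow> int) \<Rightarrow> nat \<Rightarrow> nat \<Rightarrow> int" where
  "window_seq F t k =
     (if k < t then 0 else F (k - t) (map (\<lambda>j. window_seq F t (k - t + j)) [0..<t]))"
  by auto
termination
  by (relation "Wellfounded.measure (\<lambda>(F, t, k). k)") auto

declare window_seq.simps [simp del]

lemma window_seq_step:
  "window_seq F t (k + t) = F k (map (\<lambda>j. window_seq F t (k + j)) [0..<t])"
  by (subst window_seq.simps) simp

text \<open>
  Look at the windows at the times \<open>N\<close>, \<open>N + p\<close>, \<open>N + 2p\<close>, and so on. There are only finitely
  many possible windows, so two of these agree. At these two times the recurrence is also in
  the same phase of its driving map, so from there on both continuations coincide.
\<close>

lemma finite_recurrence_periodic: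
  fixes W :: "nat \<Rightarrow> 'a"
  assumes step: "\<And>k. W (k + t) = F k (map (\<lambda>j. W (k + j)) [0..<t])"
    and F: "\<And>k. k \<ge> N \<Longrightarrow> F (k + p) = F k" and "p > 0"
    and fin: "finite (range W)"
  obtains M q where "q > 0" "\<And>k. k \<ge> M \<Longrightarrow> W (k + q) = W k"
proof -
  define win where "win i = map (\<lambda>j. W (N + i * p + j)) [0..<t]" for i
  have "range win \<subseteq> {xs. set xs \<subseteq> range W \<and> length xs = t}"
    by (auto simp: win_def)
  then have "finite (range win)"
    using finite_lists_length_eq[OF fin] finite_subset by blast
  then have "\<not> inj win"
    using finite_imageD infinite_UNIV_nat by blast
  then obtain i i' where "i < i'" and win_eq: "win i = win i'"
    unfolding inj_def by (metis linorder_neqE_nat)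
  define d where "d = i' - i"
  have d: "i' = i + d" "d > 0"
    using \<open>i < i'\<close> by (auto simp: d_def)
  have F_mult: "F (k + e * p) = F k" if "k \<ge> N" for k e
  proof (induction e)
    case (Suc e)
    then show ?case
      using F[of "k + e * p"] that by (simp add: algebra_simps)
  qed simp
  \<comment> \<open>Inside the first window this is the coincidence of windows; afterwards the recurrence
      propagates it.\<close>
  have *: "W (N + i * p + r + d * p) = W (N + i * p + r)" for r
  proof (induction r rule: less_induct)
    case (less r)
    show ?case
    proof (cases "r < t")
      case True
      have "win i ! r = win i' ! r"
        using win_eq by simp
      then show ?thesis
        using True d by (simp add: win_def algebra_simps)
    next
      case False
      define k where "k = N + i * p + (r - t)"
      have eq: "N + i * p + r = k + t" "N + i * p + r + d * p = (k + d * p) + t"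
        using False by (auto simp: k_def)
      have "W (k + d * p + j) = W (k + j)" if "j < t" for j
        using less.IH[of "r - t + j"] that False by (simp add: k_def algebra_simps)
      then have "map (\<lambda>j. W (k + d * p + j)) [0..<t] = map (\<lambda>j. W (k + j)) [0..<t]"
        by simp
      moreover have "F (k + d * p) = F k"
        by (rule F_mult) (simp add: k_def)
      ultimately show ?thesis
        unfolding eq(2) unfolding eq(1) unfolding step by (simp only:)
    qed
  qed
  show ?thesis
  proof (rule that[of "d * p" "N + i * p"])
    show "W (k + d * p) = W k" if "k \<ge> N + i * p" for k
      using *[of "k - (N + i * p)"] that by simp
  qed (use d \<open>p > 0\<close> in simp)
qed

section \<open>Inverting a primitive polynomial modulo an integer\<close>

text \<open>
  Modulo \<open>P\<close> only the coefficients of \<open>f\<close> up to the last one not divisible by \<open>P\<close>, of index \<open>t\<close>,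
  matter, and that one is invertible. Hence the congruence at position \<open>k\<close> can be solved for
  \<open>w (k + t)\<close> in terms of the \<open>t\<close> preceding values and \<open>y k\<close>. Taking representatives modulo \<open>P\<close>
  confines \<open>w\<close> to a finite set, and the driving input \<open>y\<close> is eventually periodic.
\<close>

lemma poly_act_solvable_mod_prime:
  fixes P :: int
  assumes "prime P" and c: "\<not> P dvd coeff f i"
    and y: "laurent_periodic y"
  obtains w where "laurent_periodic w" "\<And>k. [poly_act f w k = y k] (mod P)"
proof -
  define t where "t = Max {j. \<not> P dvd coeff f j}"
  have fin: "finite {j. \<not> P dvd coeff f j}"
    by (rule finite_subset[of _ "{..degree f}"]) (auto intro: le_degree)
  have "t \<in> {j. \<not> P dvd coeff f j}"
    unfolding t_def using fin c by (intro Max_in) auto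
  then have t: "\<not> P dvd coeff f t" by simp
  have t_top: "P dvd coeff f j" if "j > t" for j
    using Max_ge[OF fin, of j] that by (auto simp: t_def)
  have t_le: "t \<le> degree f"
    using t by (auto intro: le_degree)
  have "coprime (coeff f t) P"
    using \<open>prime P\<close> t prime_imp_coprime coprime_commute by blast
  then obtain c' where c': "[coeff f t * c' = 1] (mod P)"
    using cong_solve_coprime_int by blast
  have "P > 0"
    using \<open>prime P\<close> by (simp add: prime_gt_0_int)
  obtain m N p where m: "\<And>k. k < m \<Longrightarrow> y k = 0" and "p > 0"
    and per: "\<And>k. k \<ge> N \<Longrightarrow> y (k + p) = y k"
    using y by (elim laurent_periodicE) blast
  define F where "F k xs = (c' * (y (m + int k) - (\<Sum>j<t. coeff f j * xs ! j))) mod P" for k xs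
  define W where "W = window_seq F t"
  have W_step: "W (k + t) = F k (map (\<lambda>j. W (k + j)) [0..<t])" for k
    unfolding W_def by (rule window_seq_step)
  have W_init: "W k = 0" if "k < t" for k
    unfolding W_def using that by (subst window_seq.simps) simp
  have "W k \<in> {0..<P}" for k
  proof (cases "k < t")
    case False
    then show ?thesis
      using W_step[of "k - t"] \<open>P > 0\<close> by (simp add: F_def)
  qed (use W_init \<open>P > 0\<close> in auto)
  then have "finite (range W)"
    by (meson finite_atLeastLessThan_int finite_subset image_subsetI)
  moreover have "F (k + nat p) = F k" if "k \<ge> nat (N - m)" for k
    using per[of "m + int k"] that \<open>p > 0\<close> by (intro ext) (simp add: F_def algebra_simps)
  ultimately obtain M q where "q > 0" and W_per: "\<And>k. k \<ge> M \<Longrightarrow> W (k + q) = W k"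
    using finite_recurrence_periodic[of W t F "nat (N - m)" "nat p", OF W_step] \<open>p > 0\<close>
    by (metis zero_less_nat_eq)
  \<comment> \<open>The first \<open>t\<close> terms of \<open>W\<close> are zero, so before position \<open>m\<close> the congruence reads
      \<open>0 \<equiv> 0\<close> even though \<open>f\<close> looks \<open>t\<close> places ahead.\<close>
  define w where "w k = (if k < m then 0 else W (nat (k - m)))" for k
  show ?thesis
  proof (rule that)
    show "laurent_periodic w"
    proof (rule laurent_periodicI)
      show "w k = 0" if "k < m" for k
        using that by (simp add: w_def)
      show "w (k + int q) = w k" if "k \<ge> m + int M" for k
        using that W_per[of "nat (k - m)"] by (simp add: w_def nat_add_distrib algebra_simps flip: nat_int_add)
    qed (use \<open>q > 0\<close> in simp)
    show "[poly_act f w k = y k] (mod P)" for k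
    proof -
      have "poly_act f w k = (\<Sum>j\<le>t. coeff f j * w (k + int j)) + (\<Sum>j\<in>{t<..degree f}. coeff f j * w (k + int j))"
        unfolding poly_act_def
        by (subst sum.union_disjoint[symmetric]) (use t_le in \<open>auto intro!: sum.cong\<close>)
      moreover have "P dvd (\<Sum>j\<in>{t<..degree f}. coeff f j * w (k + int j))"
        by (intro dvd_sum dvd_mult2 t_top) simp
      ultimately have 1: "[poly_act f w k = (\<Sum>j\<le>t. coeff f j * w (k + int j))] (mod P)"
        by (simp add: cong_iff_dvd_diff)
      have "[(\<Sum>j\<le>t. coeff f j * w (k + int j)) = y k] (mod P)"
      proof (cases "k < m")
        case True
        have "w (k + int j) = 0" if "j \<le> t" for j
          using that True by (auto simp: w_def intro!: W_init)
        then show ?thesis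
          using m[OF True] by simp
      next
        case False
        define n where "n = nat (k - m)"
        have k: "k = m + int n"
          using False by (simp add: n_def)
        have w: "w (k + int j) = W (n + j)" for j
          by (simp add: w_def k nat_add_distrib)
        define S where "S = (\<Sum>j<t. coeff f j * W (n + j))"
        have "(\<Sum>j\<le>t. coeff f j * w (k + int j)) = S + coeff f t * W (n + t)"
          by (simp add: S_def w lessThan_Suc_atMost[symmetric])
        moreover have "W (n + t) = (c' * (y k - S)) mod P"
          unfolding W_step by (simp add: F_def k S_def)
        moreover have "[coeff f t * ((c' * (y k - S)) mod P) = (coeff f t * c') * (y k - S)] (mod P)"
          by (simp add: cong_def mod_mult_right_eq mult.assoc)
        moreover have "[(coeff f t * c') * (y k - S) = 1 * (y k - S)] (mod P)"
          using c' by (rule cong_mult) simp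
        ultimately have "[(\<Sum>j\<le>t. coeff f j * w (k + int j)) = S + 1 * (y k - S)] (mod P)"
          by (metis cong_add cong_refl cong_trans)
        then show ?thesis by simp
      qed
      with 1 show ?thesis
        by (rule cong_trans)
    qed
  qed
qed

text \<open>
  A solution \<open>u\<close> modulo \<open>m\<close> leaves an error \<open>f \<cdot> u - y = m e\<close> with \<open>e\<close> again eventually periodic.
  If \<open>f \<cdot> w \<equiv> e\<close> modulo \<open>P\<close>, then \<open>u - m w\<close> has the error \<open>m (e - f \<cdot> w)\<close>, which is divisible
  by \<open>P m\<close>. The correction works alike whether or not \<open>P\<close> divides \<open>m\<close>, so prime powers
  are covered as well. Content \<open>1\<close> makes the prime case applicable to every prime factor of \<open>n\<close>.
\<close>

lemma poly_act_solvable_mod: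
  assumes f: "content f = 1" and y: "laurent_periodic y" and "n > 0"
  shows "\<exists>u. laurent_periodic u \<and> (\<forall>k. [poly_act f u k = y k] (mod int n))"
  using \<open>n > 0\<close>
proof (induction n rule: less_induct)
  case (less n)
  show ?case
  proof (cases "n = 1")
    case True
    then show ?thesis
      using y by auto
  next
    case False
    then obtain P where P: "prime P" "P dvd n"
      using prime_factor_nat by blast
    then obtain m where n: "n = P * m" by blast
    have "m > 0" "m < n"
      using less.prems P n prime_gt_1_nat[of P] by auto
    then obtain u where u: "laurent_periodic u" "\<And>k. [poly_act f u k = y k] (mod int m)"
      using less.IH by blast
    define e where "e k = (poly_act f u k - y k) div int m" for k
    have e: "poly_act f u k - y k = int m * e k" for k
      using u(2)[of k] by (simp add: e_def cong_iff_dvd_diff)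
    have "laurent_periodic e"
      unfolding e_def[abs_def]
      by (rule laurent_periodic_map2[OF laurent_periodic_poly_act[OF u(1)] y]) simp
    moreover obtain i where "\<not> int P dvd coeff f i"
    proof -
      have "\<not> (\<forall>i. int P dvd coeff f i)"
      proof
        assume "\<forall>i. int P dvd coeff f i"
        then have "[:int P:] dvd f"
          by (simp add: const_poly_dvd_iff)
        then have "int P dvd content f"
          by (simp add: const_poly_dvd_iff_dvd_content)
        then show False
          using f P(1) by auto
      qed
      then show ?thesis
        using that by blast
    qed
    moreover have "prime (int P)"
      using P by simp
    ultimately obtain w where w: "laurent_periodic w" "\<And>k. [poly_act f w k = e k] (mod int P)"
      using poly_act_solvable_mod_prime by metis
    have "laurent_periodic (\<lambda>k. u k - int m * w k)"
      by (rule laurent_periodic_map2[OF u(1) w(1)]) simp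
    moreover have "[poly_act f (\<lambda>k. u k - int m * w k) k = y k] (mod int n)" for k
    proof -
      have "poly_act f (\<lambda>k. u k - int m * w k) k - y k = int m * (e k - poly_act f w k)"
        using e[of k] by (simp add: poly_act_diff_scaled algebra_simps)
      moreover have "int P dvd e k - poly_act f w k"
        using w(2)[of k] by (simp add: cong_iff_dvd_diff dvd_diff_commute)
      ultimately show ?thesis
        by (simp add: cong_iff_dvd_diff n mult.commute mult_dvd_mono)
    qed
    ultimately show ?thesis by blast
  qed
qed

section \<open>Evaluation at the base\<close>

text \<open>Past its starting point the series is dominated by a geometric series.\<close>

lemma laurent_series_summable:
  fixes \<beta> :: complex and a :: "int \<Rightarrow> int"
  assumes "cmod \<beta> > 1" and zero: "\<And>k. k < m \<Longrightarrow> a k = 0" and bound: "\<And>k. \<bar>a k\<bar> \<le> B"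
  shows "(\<lambda>k. of_int (a k) * \<beta> powi (-k)) summable_on UNIV"
proof -
  have "\<beta> \<noteq> 0"
    using assms(1) by auto
  \<comment> \<open>Absolute summability is read off an ordinary series by counting from \<open>m\<close>.\<close>
  have "bij_betw (\<lambda>i. m + int i) UNIV {m..}"
    by (rule bij_betwI[of _ _ _ "\<lambda>k. nat (k - m)"]) auto
  moreover have "(\<lambda>i. of_int (a (m + int i)) * \<beta> powi (-(m + int i))) summable_on UNIV"
  proof (rule norm_summable_imp_summable_on)
    have "summable (\<lambda>i. (of_int B * cmod (\<beta> powi (-m))) * inverse (cmod \<beta>) ^ i)"
      by (intro summable_mult summable_geometric) (use assms(1) in \<open>auto simp: inverse_less_1_iff\<close>)
    then show "summable (\<lambda>i. norm (of_int (a (m + int i)) * \<beta> powi (-(m + int i))))"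
    proof (rule summable_comparison_test'[where N = 0])
      fix i :: nat
      have "\<beta> powi (-(m + int i)) = \<beta> powi (-m) * inverse \<beta> ^ i"
        using \<open>\<beta> \<noteq> 0\<close> by (simp add: power_int_diff power_int_minus divide_inverse power_inverse)
      moreover have "norm (of_int (a (m + int i)) :: complex) \<le> of_int B"
        using bound[of "m + int i"] by (metis norm_of_int of_int_le_iff of_int_abs)
      ultimately show "norm (norm (of_int (a (m + int i)) * \<beta> powi (-(m + int i))))
          \<le> (of_int B * cmod (\<beta> powi (-m))) * inverse (cmod \<beta>) ^ i"
        by (simp add: norm_mult norm_power norm_inverse mult.assoc mult_right_mono)
    qed
  qed
  ultimately have "(\<lambda>k. of_int (a k) * \<beta> powi (-k)) summable_on {m..}"
    by (subst summable_on_reindex_bij_betw[symmetric]) auto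
  moreover have "(\<lambda>k. of_int (a k) * \<beta> powi (-k)) summable_on {m..} \<longleftrightarrow> ?thesis"
    by (rule summable_on_cong_neutral) (auto simp: zero)
  ultimately show ?thesis by simp
qed

lemma has_sum_finite_sum:
  fixes f :: "'i \<Rightarrow> 'a \<Rightarrow> 'b::topological_comm_monoid_add"
  assumes "finite I" "\<And>i. i \<in> I \<Longrightarrow> (f i has_sum s i) A"
  shows "((\<lambda>x. \<Sum>i\<in>I. f i x) has_sum (\<Sum>i\<in>I. s i)) A"
  using assms by (induction I rule: finite_induct) (auto intro!: has_sum_add)

text \<open>
  Summation over all integers is invariant under shifts, so no boundary terms appear and
  evaluation at \<open>\<beta>\<close> turns the action of \<open>f\<close> into multiplication by \<open>f(\<beta>)\<close>.
\<close>

lemma poly_act_has_sum: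
  fixes \<beta> :: complex
  assumes "\<beta> \<noteq> 0" and a: "((\<lambda>k. of_int (a k) * \<beta> powi (-k)) has_sum T) UNIV"
  shows "((\<lambda>k. of_int (poly_act f a k) * \<beta> powi (-k)) has_sum
            poly (map_poly of_int f) \<beta> * T) UNIV"
proof -
  have shift: "((\<lambda>k. of_int (a (k + j)) * \<beta> powi (-(k + j))) has_sum T) UNIV" for j
  proof -
    have "bij_betw (\<lambda>k. k + j) UNIV UNIV"
      by (rule bij_betwI[of _ _ _ "\<lambda>k. k - j"]) auto
    from has_sum_reindex_bij_betw[OF this, of "\<lambda>k. of_int (a k) * \<beta> powi (-k)"] a
    show ?thesis by simp
  qed
  have "((\<lambda>k. \<Sum>j\<le>degree f. (of_int (coeff f j) * \<beta> ^ j) *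
            (of_int (a (k + int j)) * \<beta> powi (-(k + int j))))
          has_sum (\<Sum>j\<le>degree f. (of_int (coeff f j) * \<beta> ^ j) * T)) UNIV"
    by (intro has_sum_finite_sum has_sum_cmult_right shift) auto
  moreover have "(\<Sum>j\<le>degree f. (of_int (coeff f j) * \<beta> ^ j) *
            (of_int (a (k + int j)) * \<beta> powi (-(k + int j)))) =
          of_int (poly_act f a k) * \<beta> powi (-k)" for k
  proof -
    have "\<beta> ^ j * \<beta> powi (-(k + int j)) = \<beta> powi (-k)" for j
      using \<open>\<beta> \<noteq> 0\<close> by (simp add: power_int_diff power_int_minus)
    then show ?thesis
      unfolding poly_act_def of_int_sum sum_distrib_right
      by (intro sum.cong) (simp_all add: mult_ac)
  qed
  moreover have "(\<Sum>j\<le>degree f. (of_int (coeff f j) * \<beta> ^ j) * T) = poly (map_poly of_int f) \<beta> * T"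
    by (simp add: poly_altdef sum_distrib_right degree_map_poly coeff_map_poly)
  ultimately show ?thesis by simp
qed

lemma algebraic_primitive_poly:
  fixes x :: complex
  assumes "algebraic x"
  obtains f :: "int poly" where "content f = 1" "poly (map_poly of_int f) x = 0"
proof -
  obtain g :: "int poly" where g: "g \<noteq> 0" "poly (map_poly of_int g) x = 0"
    using algebraicE'[OF assms] by blast
  have "map_poly of_int g = smult (of_int (content g)) (map_poly of_int (primitive_part g) :: complex poly)"
    by (intro poly_eqI)
       (metis (no_types, lifting) coeff_map_poly coeff_smult content_times_primitive_part of_int_0 of_int_mult)
  then have "poly (map_poly of_int (primitive_part g)) x = 0"
    using g by simp
  then show ?thesis
    using that[of "primitive_part g"] g(1) by simp
qed

section \<open>Reciprocals of the positive integers\<close>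

theorem theorem4p1:
  fixes \<beta> :: complex
  assumes "algebraic \<beta>"
    and "cmod \<beta> > 1"
    and "\<exists>\<beta>'\<in>galois_conjugates \<beta>. cmod \<beta>' = 1"
  shows "\<exists>A. alphabet A \<and> A \<subseteq> \<int> \<and> (\<forall>n::nat. n > 0 \<longrightarrow> 1 / of_nat n \<in> Per A \<beta>)"
proof -
  have "\<beta> \<noteq> 0"
    using assms(2) by auto
  obtain f where f: "content f = 1" and root: "poly (map_poly of_int f) \<beta> = 0"
    using algebraic_primitive_poly[OF assms(1)] by blast
  \<comment> \<open>The digit bound: \<open>1\<close> for the unit digit of \<open>\<delta>\<close> and the length of \<open>f\<close> for \<open>f \<cdot> v\<close>, after
      division by \<open>n\<close>.\<close>
  define C where "C = 1 + (\<Sum>j\<le>degree f. \<bar>coeff f j\<bar>)"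
  have "C \<ge> 0"
    by (simp add: C_def add_nonneg_nonneg sum_nonneg)
  define A :: "complex set" where "A = of_int ` {-C..C}"
  have "alphabet A" "A \<subseteq> \<int>"
    using \<open>C \<ge> 0\<close> by (auto simp: alphabet_def A_def intro: image_eqI[of _ _ 0])
  moreover have "1 / of_nat n \<in> Per A \<beta>" if "n > 0" for n :: nat
  proof -
    define \<delta> :: "int \<Rightarrow> int" where "\<delta> k = (if k = 0 then 1 else 0)" for k
    have \<delta>: "laurent_periodic \<delta>"
      by (rule laurent_periodic_finite_support[of 0 _ 1]) (auto simp: \<delta>_def)
    have "laurent_periodic (\<lambda>k. - \<delta> k)"
      by (rule laurent_periodic_map[OF \<delta>]) simp
    then obtain u where u: "laurent_periodic u" "\<And>k. [poly_act f u k = - \<delta> k] (mod int n)"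
      using poly_act_solvable_mod[OF f _ \<open>n > 0\<close>] by metis
    \<comment> \<open>Reducing to \<open>[0, n)\<close> keeps the congruence and bounds the digits \<open>d\<close> below
        independently of \<open>n\<close>.\<close>
    define v where "v k = u k mod int n" for k
    have v: "laurent_periodic v"
      unfolding v_def[abs_def] by (rule laurent_periodic_map[OF u(1)]) simp
    have v_bound: "\<bar>v k\<bar> \<le> int n" for k
      using \<open>n > 0\<close> by (simp add: v_def less_imp_le)
    define d where "d k = (\<delta> k + poly_act f v k) div int n" for k
    have d: "\<delta> k + poly_act f v k = int n * d k" for k
    proof -
      have "[poly_act f v k = - \<delta> k] (mod int n)"
        using poly_act_mod u(2) unfolding v_def[abs_def] by (rule cong_trans)
      then show ?thesis
        by (simp add: d_def cong_iff_dvd_diff add.commute)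
    qed
    have "laurent_periodic d"
      unfolding d_def[abs_def]
      by (rule laurent_periodic_map2[OF \<delta> laurent_periodic_poly_act[OF v]]) simp
    then obtain m where m: "\<And>k. k < m \<Longrightarrow> d k = 0" and per: "eventually_periodic_from m d"
      unfolding laurent_periodic_def by blast
    have d_A: "of_int (d k) \<in> A" for k
    proof -
      have "\<bar>poly_act f v k\<bar> \<le> (\<Sum>j\<le>degree f. \<bar>coeff f j\<bar> * int n)"
        unfolding poly_act_def
        by (rule order_trans[OF sum_abs]) (intro sum_mono, simp add: abs_mult mult_left_mono v_bound)
      moreover have "\<bar>\<delta> k\<bar> \<le> int n"
        using \<open>n > 0\<close> by (simp add: \<delta>_def)
      ultimately have "\<bar>int n * d k\<bar> \<le> int n * C"
        unfolding d[symmetric] C_def by (simp add: algebra_simps sum_distrib_left)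
      then have "\<bar>d k\<bar> \<le> C"
        using \<open>n > 0\<close> by (simp add: abs_mult)
      then show ?thesis
        by (simp add: A_def abs_le_iff)
    qed
    obtain m' where m': "\<And>k. k < m' \<Longrightarrow> v k = 0"
      using v by (elim laurent_periodicE) blast
    obtain T where T: "((\<lambda>k. of_int (v k) * \<beta> powi (-k)) has_sum T) UNIV"
      using laurent_series_summable[of \<beta> m' v, OF assms(2) m' v_bound] by (auto simp: summable_on_def)
    \<comment> \<open>The correction \<open>f \<cdot> v\<close> represents \<open>f(\<beta>) T = 0\<close>, so the number represented is still
        \<open>1/n\<close>.\<close>
    have "((\<lambda>k. of_int (poly_act f v k) * \<beta> powi (-k)) has_sum 0) UNIV"
      using poly_act_has_sum[OF \<open>\<beta> \<noteq> 0\<close> T, of f] root by simp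
    moreover have "((\<lambda>k. of_int (\<delta> k) * \<beta> powi (-k)) has_sum 1) UNIV"
    proof -
      have "((\<lambda>k. of_int (\<delta> k) * \<beta> powi (-k)) has_sum 1) {0}"
        by (rule has_sum_finiteI) (auto simp: \<delta>_def)
      moreover have "((\<lambda>k. of_int (\<delta> k) * \<beta> powi (-k)) has_sum 1) {0} \<longleftrightarrow>
          ((\<lambda>k. of_int (\<delta> k) * \<beta> powi (-k)) has_sum 1) UNIV"
        by (rule has_sum_cong_neutral) (auto simp: \<delta>_def)
      ultimately show ?thesis by simp
    qed
    ultimately have "((\<lambda>k. of_int (\<delta> k) * \<beta> powi (-k) + of_int (poly_act f v k) * \<beta> powi (-k))
        has_sum (1 + 0)) UNIV"
      by (intro has_sum_add)
    then have "((\<lambda>k. 1 / of_nat n * (of_int (\<delta> k) * \<beta> powi (-k) + of_int (poly_act f v k) * \<beta> powi (-k)))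
        has_sum (1 / of_nat n * (1 + 0))) UNIV"
      by (rule has_sum_cmult_right)
    moreover have "1 / of_nat n * (of_int (\<delta> k) * \<beta> powi (-k) + of_int (poly_act f v k) * \<beta> powi (-k))
        = of_int (d k) * \<beta> powi (-k)" for k
    proof -
      have "of_int (\<delta> k) + of_int (poly_act f v k) = (of_nat n * of_int (d k) :: complex)"
        using arg_cong[OF d[of k], of "of_int :: int \<Rightarrow> complex"] by simp
      then show ?thesis
        using \<open>n > 0\<close> by (simp flip: distrib_right)
    qed
    ultimately have "((\<lambda>k. of_int (d k) * \<beta> powi (-k)) has_sum (1 / of_nat n)) UNIV"
      by simp
    moreover have "((\<lambda>k. of_int (d k) * \<beta> powi (-k)) has_sum (1 / of_nat n)) UNIV \<longleftrightarrow>
        ((\<lambda>k. of_int (d k) * \<beta> powi (-k)) has_sum (1 / of_nat n)) {m..}"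
      by (rule has_sum_cong_neutral) (auto simp: m)
    moreover have "eventually_periodic_from m (\<lambda>k. of_int (d k) :: complex)"
      using per unfolding eventually_periodic_from_def by auto
    ultimately show ?thesis
      unfolding Per_def using d_A
      by (intro CollectI exI[of _ "-m"] exI[of _ "\<lambda>k. of_int (d k)"]) auto
  qed
  ultimately show ?thesis by blast
qed

end
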